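(* Let $\mathcal L$ be an MR-algebra and let $[x]$ denote the $\simeq$-class of $x\in\mathcal L$. For all $a,b\in\mathcal L$, the greatest lower bound of $[a]$ and $[b]$ in $\mathcal L/{\simeq}$ exists, and $$[a]\wedge[b]=[a\mathbin{\hat{\ }}b].$$
   Context: A cubic algebra is a join-semilattice with greatest element $1$ and an operation $\Delta$ (only the values $\Delta(y,x)$ with $x\le y$ matter) such that: (1) $x\le y$ implies $\Delta(y,x)\vee x=y$; (2) $x\le y\le z$ implies $\Delta(z,\Delta(y,x))=\Delta(\Delta(z,y),\Delta(z,x))$; (3) $x\le y$ implies $\Delta(y,\Delta(y,x))=x$; (4) $x\le y\le z$ implies $\Delta(z,x)\le\Delta(z,y)$; and, writing $xy=\Delta(1,\Delta(x\vee y,y))\vee y$, (5) $(xy)y=x\vee y$; (6) $x(yz)=y(xz)$. We write $x\rightarrow y$ for $xy$. An MR-algebra is a cubic algebra satisfying the MR-axiom: for all $a,b<x$, $\Delta(x,a)\vee b<x$ if and only if the meet (greatest lower bound) $a\wedge b$ does not exist. In an MR-algebra the caret operation $a\mathbin{\hat{\ }}b=a\wedge\Delta(a\vee b,b)$ is defined for all $a,b$. The relation $a\simeq b$ means $\Delta(a\vee b,a)=b$; it is an equivalence relation on $\mathcal L$. Define $a\Rightarrow b=\Delta(a\vee b,a)\rightarrow b$. This induces a well-defined implication operation $[a]\rightarrow[b]=[a\Rightarrow b]$ on $\mathcal L/{\simeq}$, making it an implication algebra whose order is: $[a]\le[b]$ iff $[a]\rightarrow[b]=[1]$. *)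

theory Defs
  imports "HOL-Algebra.Lattice"
begin

text \<open>Below, \<open>sup\<close> and \<open>top\<close> are the type class operations, while \<open>is_glb\<close> and
  \<open>\<sqinter>\<close> are the record-based notions of HOL-Algebra.\<close>

hide_const (open) Lattice.sup Order.top

text \<open>The operation \<open>\<Delta>\<close> is total in HOL; every axiom and definition applies \<open>\<Delta> y x\<close> only
  with \<open>x \<le> y\<close>.\<close>

definition imp ::
  "('a \<Rightarrow> 'a \<Rightarrow> 'a) \<Rightarrow> 'a \<Rightarrow> 'a \<Rightarrow> 'a::{semilattice_sup,order_top}"
  where "imp \<Delta> x y = sup (\<Delta> top (\<Delta> (sup x y) y)) y"

locale cubic_algebra =
  fixes \<Delta> :: "'a \<Rightarrow> 'a \<Rightarrow> 'a::{semilattice_sup,order_top}"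
  assumes Delta_sup: "x \<le> y \<Longrightarrow> sup (\<Delta> y x) x = y"
    and Delta_Delta: "\<lbrakk>x \<le> y; y \<le> z\<rbrakk> \<Longrightarrow> \<Delta> z (\<Delta> y x) = \<Delta> (\<Delta> z y) (\<Delta> z x)"
    and Delta_invol: "x \<le> y \<Longrightarrow> \<Delta> y (\<Delta> y x) = x"
    and Delta_mono: "\<lbrakk>x \<le> y; y \<le> z\<rbrakk> \<Longrightarrow> \<Delta> z x \<le> \<Delta> z y"
    and imp_imp: "imp \<Delta> (imp \<Delta> x y) y = sup x y"
    and imp_exchange: "imp \<Delta> x (imp \<Delta> y z) = imp \<Delta> y (imp \<Delta> x z)"

definition type_order :: "'a::order gorder"
  where "type_order = \<lparr>carrier = UNIV, eq = (=), le = (\<le>)\<rparr>"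

definition has_meet :: "'a::order \<Rightarrow> 'a \<Rightarrow> bool"
  where "has_meet a b \<longleftrightarrow> (\<exists>m. is_glb type_order m {a, b})"

locale MR_algebra = cubic_algebra +
  assumes MR_axiom: "\<lbrakk>a < x; b < x\<rbrakk> \<Longrightarrow> sup (\<Delta> x a) b < x \<longleftrightarrow> \<not> has_meet a b"

text \<open>The value is meaningful because, in an MR-algebra, the meet in question always exists.\<close>

definition caret ::
  "('a \<Rightarrow> 'a \<Rightarrow> 'a) \<Rightarrow> 'a \<Rightarrow> 'a \<Rightarrow> 'a::semilattice_sup"
  where "caret \<Delta> a b = a \<sqinter>\<^bsub>type_order\<^esub> \<Delta> (sup a b) b"

definition sim_rel :: "('a \<Rightarrow> 'a \<Rightarrow> 'a) \<Rightarrow> ('a::semilattice_sup \<times> 'a) set"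
  where "sim_rel \<Delta> = {(a, b). \<Delta> (sup a b) a = b}"

definition sim_class ::
  "('a \<Rightarrow> 'a \<Rightarrow> 'a) \<Rightarrow> 'a::semilattice_sup \<Rightarrow> 'a set"
  where "sim_class \<Delta> a = sim_rel \<Delta> `` {a}"

definition Imp ::
  "('a \<Rightarrow> 'a \<Rightarrow> 'a) \<Rightarrow> 'a \<Rightarrow> 'a \<Rightarrow> 'a::{semilattice_sup,order_top}"
  where "Imp \<Delta> a b = imp \<Delta> (\<Delta> (sup a b) a) b"

text \<open>The operation \<open>[a] \<rightarrow> [b] = [a \<Rightarrow> b]\<close> on classes: as \<open>[a \<Rightarrow> b]\<close> does not depend on the
  representatives, the union below is just this common class.\<close>

definition class_imp ::
  "('a \<Rightarrow> 'a \<Rightarrow> 'a) \<Rightarrow> 'a set \<Rightarrow> 'a set \<Rightarrow> 'a::{semilattice_sup,order_top} set"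
  where "class_imp \<Delta> A B = (\<Union>a\<in>A. \<Union>b\<in>B. sim_class \<Delta> (Imp \<Delta> a b))"

definition sim_quotient ::
  "('a \<Rightarrow> 'a \<Rightarrow> 'a) \<Rightarrow> 'a::{semilattice_sup,order_top} set gorder"
  where "sim_quotient \<Delta> =
    \<lparr>carrier = UNIV // sim_rel \<Delta>, eq = (=),
     le = (\<lambda>A B. class_imp \<Delta> A B = sim_class \<Delta> top)\<rparr>"

end

theory Submission
  imports Defs
begin

text \<open>Write \<open>a \<lesssim> b\<close> for \<open>\<Delta> (sup a b) a \<le> b\<close>; this says that some element similar to \<open>a\<close> lies
  below \<open>b\<close>, and it describes the order of the quotient. Put \<open>b1 = \<Delta> (sup a b) b\<close>, which is similar
  to \<open>b\<close>, so that the caret of \<open>a\<close> and \<open>b\<close> is the meet \<open>c\<close> of \<open>a\<close> and \<open>b1\<close>. If \<open>d \<lesssim> a\<close> and \<open>d \<lesssim> b\<close>,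
  then \<open>d \<lesssim> b1\<close>. The MR-axiom makes the meet of \<open>r = \<Delta> (sup d c) d\<close> and \<open>c\<close> exist, and this common
  lower bound forces \<open>r \<le> e\<close> for every \<open>e \<ge> c\<close> with \<open>d \<lesssim> e\<close>. Hence \<open>r\<close> lies below both \<open>a\<close> and \<open>b1\<close>,
  so \<open>r \<le> c\<close> and \<open>d \<lesssim> c\<close>.\<close>

lemma is_glb_pair_iff:
  fixes L (structure)
  assumes "a \<in> carrier L" "b \<in> carrier L"
  shows "is_glb L m {a, b} \<longleftrightarrow>
    m \<in> carrier L \<and> m \<sqsubseteq> a \<and> m \<sqsubseteq> b \<and> (\<forall>d\<in>carrier L. d \<sqsubseteq> a \<and> d \<sqsubseteq> b \<longrightarrow> d \<sqsubseteq> m)"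
  using assms unfolding greatest_def Lower_def by blast

lemma is_glb_type_order_iff:
  "is_glb type_order m {a, b} \<longleftrightarrow> m \<le> a \<and> m \<le> b \<and> (\<forall>d. d \<le> a \<and> d \<le> b \<longrightarrow> d \<le> m)"
  using is_glb_pair_iff[of a type_order b m] by (simp add: type_order_def)

context cubic_algebra
begin

abbreviation arrow :: "'a \<Rightarrow> 'a \<Rightarrow> 'a" (infixr "\<leadsto>" 65)
  where "x \<leadsto> y \<equiv> imp \<Delta> x y"

abbreviation sim :: "'a \<Rightarrow> 'a \<Rightarrow> bool" (infix "\<simeq>" 50)
  where "a \<simeq> b \<equiv> (a, b) \<in> sim_rel \<Delta>"

definition subsim :: "'a \<Rightarrow> 'a \<Rightarrow> bool" (infix "\<lesssim>" 50)
  where "a \<lesssim> b \<longleftrightarrow> \<Delta> (sup a b) a \<le> b"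

section \<open>Reflections as order automorphisms of intervals\<close>

lemma Delta_le: "x \<le> y \<Longrightarrow> \<Delta> y x \<le> y"
  by (metis Delta_sup sup_ge1)

lemma Delta_self [simp]: "\<Delta> x x = x"
  by (metis Delta_invol Delta_le Delta_mono order_antisym order_refl)

lemma Delta_le_swap: "\<lbrakk>x \<le> z; y \<le> z; \<Delta> z x \<le> y\<rbrakk> \<Longrightarrow> x \<le> \<Delta> z y"
  by (metis Delta_invol Delta_mono)

lemma Delta_join:
  assumes "x \<le> z" "y \<le> z"
  shows "\<Delta> z (sup x y) = sup (\<Delta> z x) (\<Delta> z y)"
proof (rule order_antisym)
  have "x \<le> \<Delta> z (sup (\<Delta> z x) (\<Delta> z y))" "y \<le> \<Delta> z (sup (\<Delta> z x) (\<Delta> z y))"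
    by (rule Delta_le_swap; use assms in \<open>simp add: Delta_le\<close>)+
  then have "sup x y \<le> \<Delta> z (sup (\<Delta> z x) (\<Delta> z y))"
    by simp
  from Delta_mono[OF this, of z] show "\<Delta> z (sup x y) \<le> sup (\<Delta> z x) (\<Delta> z y)"
    using assms by (simp add: Delta_invol Delta_le)
  show "sup (\<Delta> z x) (\<Delta> z y) \<le> \<Delta> z (sup x y)"
    using assms by (simp add: Delta_mono)
qed

section \<open>The implication algebra given by \<leadsto>\<close>

lemma arrow_eq: "y \<le> x \<Longrightarrow> x \<leadsto> y = sup (\<Delta> top (\<Delta> x y)) y"
  by (simp add: imp_def sup_absorb1)

lemma top_arrow [simp]: "top \<leadsto> x = x"
  by (simp add: arrow_eq Delta_invol)

lemma arrow_self [simp]: "x \<leadsto> x = top"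
  by (simp add: arrow_eq Delta_sup)

lemma arrow_sup_left: "sup x y \<leadsto> y = x \<leadsto> y"
  by (simp add: imp_def)

lemma arrow_eq_top_iff: "x \<leadsto> y = top \<longleftrightarrow> x \<le> y"
  by (metis arrow_self arrow_sup_left imp_imp sup.absorb_iff2 top_arrow)

lemma le_arrow_iff: "x \<le> y \<leadsto> z \<longleftrightarrow> y \<le> x \<leadsto> z"
  by (metis arrow_eq_top_iff imp_exchange)

lemma arrow_antimono: "x \<le> y \<Longrightarrow> y \<leadsto> z \<le> x \<leadsto> z"
  by (metis imp_imp le_arrow_iff order_trans sup_ge1)

lemma le_arrow: "y \<le> x \<leadsto> y"
  by (simp add: le_arrow_iff)

lemma arrow_mono:
  assumes "y \<le> z"
  shows "x \<leadsto> y \<le> x \<leadsto> z"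
proof -
  \<comment> \<open>Writing \<open>z\<close> as \<open>(z \<leadsto> y) \<leadsto> y\<close> lets
    the exchange law bring out \<open>x \<leadsto> y\<close>.\<close>
  have "x \<leadsto> z = x \<leadsto> ((z \<leadsto> y) \<leadsto> y)"
    using assms by (simp add: imp_imp sup_absorb1)
  also have "\<dots> = (z \<leadsto> y) \<leadsto> (x \<leadsto> y)"
    by (rule imp_exchange)
  finally show ?thesis
    by (simp add: le_arrow)
qed

lemma arrow_sup_self: "sup (x \<leadsto> y) x = top"
proof -
  have "sup (x \<leadsto> y) x = sup (\<Delta> top (\<Delta> (sup x y) y)) (sup x y)"
    by (simp add: imp_def ac_simps)
  also have "\<dots> = sup (sup (\<Delta> top (\<Delta> (sup x y) y)) (\<Delta> (sup x y) y)) (sup x y)"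
    by (simp add: Delta_le sup.absorb2 sup_assoc)
  finally show ?thesis
    by (simp add: Delta_sup sup_absorb1)
qed

text \<open>\<open>x\<close> and \<open>x \<leadsto> y\<close> always join to \<open>top\<close>, so
  the hypothesis turns \<open>x \<leadsto> y\<close> into \<open>top\<close>.\<close>

lemma le_arrow_self:
  assumes "x \<le> x \<leadsto> y"
  shows "x \<le> y"
  using assms arrow_sup_self[of x y] by (metis arrow_eq_top_iff sup.absorb1)

lemma modus_ponens: "\<lbrakk>z \<le> s; z \<le> s \<leadsto> r\<rbrakk> \<Longrightarrow> z \<le> r"
  by (meson arrow_antimono le_arrow_self order_trans)

text \<open>Stands in for distributivity where meets may fail to exist: \<open>sup s e\<close>
  equals \<open>(s \<leadsto> e) \<leadsto> e\<close>, so modus ponens at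
  \<open>s \<leadsto> e\<close> removes \<open>s\<close> from the cover.\<close>

lemma cut:
  assumes "z \<le> sup s e" "z \<le> s \<leadsto> r" "r \<le> e"
  shows "z \<le> e"
proof -
  have "z \<le> s \<leadsto> e"
    using assms arrow_mono order_trans by blast
  then show ?thesis
    using assms(1) by (metis imp_imp modus_ponens)
qed

section \<open>Nested reflections\<close>

lemma Delta_le_sup:
  assumes "j \<le> s" "s \<le> w"
  shows "\<Delta> w j \<le> sup (\<Delta> s j) (\<Delta> top j)"
proof -
  have jw: "j \<le> w"
    using assms by simp
  \<comment> \<open>After reflection in \<open>top\<close>, the claim is that implication is
    antitone in its first argument.\<close>
  have "\<Delta> top (\<Delta> w j) \<le> w \<leadsto> j"
    by (simp add: arrow_eq jw)
  also have "\<dots> \<le> s \<leadsto> j"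
    using assms arrow_antimono by blast
  finally have "\<Delta> top (\<Delta> w j) \<le> s \<leadsto> j" .
  then have "\<Delta> w j \<le> \<Delta> top (s \<leadsto> j)"
    by (simp add: Delta_le_swap)
  also have "\<dots> = sup (\<Delta> s j) (\<Delta> top j)"
    by (simp add: arrow_eq assms Delta_join Delta_invol)
  finally show ?thesis .
qed

lemma Delta_Delta_le_arrow:
  assumes "k \<le> s" "s \<le> w"
  shows "\<Delta> w (\<Delta> s k) \<le> s \<leadsto> k"
  using Delta_le_sup[of "\<Delta> s k" s w] assms
  by (simp add: Delta_le Delta_invol arrow_eq sup_commute)

text \<open>The double reflection lies below \<open>s \<leadsto> r\<close>, the complement of
  \<open>s\<close> above \<open>r\<close>, while \<open>s\<close> and \<open>e\<close> cover it; so
  \<open>cut\<close> applies. This is what later carries \<lesssim> along \<simeq>.\<close>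

lemma Delta_Delta_le:
  assumes "r \<le> s" "r \<le> e"
  shows "\<Delta> (sup s e) (\<Delta> s r) \<le> e"
proof (rule cut)
  show "\<Delta> (sup s e) (\<Delta> s r) \<le> sup s e"
    using assms by (meson Delta_le order_trans sup_ge1)
  show "\<Delta> (sup s e) (\<Delta> s r) \<le> s \<leadsto> r"
    using assms by (simp add: Delta_Delta_le_arrow)
qed (use assms in simp)

text \<open>The heart of transitivity: \<open>e = sup k (\<Delta> w (\<Delta> s k))\<close> is the complement of \<open>s\<close> in the interval
  from \<open>k\<close> to \<open>w\<close>, and both sides are the meet of \<open>e\<close> and \<open>\<Delta> w s\<close>.\<close>

lemma Delta_Delta_nested:
  assumes "k \<le> s" "s \<le> w"
  shows "\<Delta> w (\<Delta> s k) = \<Delta> (sup k (\<Delta> w (\<Delta> s k))) k"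
proof -
  define j where "j = \<Delta> s k"
  define g where "g = \<Delta> w j"
  define e where "e = sup k g"
  define h where "h = \<Delta> e k"
  have kw: "k \<le> w"
    using assms by simp
  have js: "j \<le> s"
    using assms(1) by (simp add: j_def Delta_le)
  then have jw: "j \<le> w"
    using assms(2) by simp
  have ke: "k \<le> e"
    by (simp add: e_def)
  then have he: "h \<le> e"
    by (simp add: h_def Delta_le)
  have gw: "g \<le> w"
    by (simp add: g_def jw Delta_le)
  have ew: "e \<le> w"
    by (simp add: e_def gw kw)
  have gs: "g \<le> s \<leadsto> k"
    using Delta_Delta_le_arrow assms by (simp add: g_def j_def)
  have es: "e \<le> s \<leadsto> k"
    using gs by (simp add: e_def le_arrow)
  have "w = sup g j"
    by (simp add: g_def jw Delta_sup)
  also have "\<dots> \<le> sup e s"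
    using js by (intro sup_mono) (simp_all add: e_def)
  finally have w_eq: "w = sup e s"
    by (rule order_antisym) (simp add: ew assms)
  have hs: "\<Delta> w h \<le> s"
    unfolding w_eq h_def by (rule Delta_Delta_le) (use assms ke in auto)
  have hw: "h \<le> w"
    using he ew by simp
  \<comment> \<open>\<open>s\<close> is covered by \<open>e\<close> and
    \<open>sup k (\<Delta> w h)\<close>, and it is disjoint from \<open>e\<close> relative to
    \<open>k\<close>, so \<open>cut\<close> will drop \<open>e\<close>.\<close>
  have "w = sup (\<Delta> w h) h"
    by (simp add: hw Delta_sup)
  also have "\<dots> \<le> sup e (sup k (\<Delta> w h))"
    using he by (simp add: le_supI1 le_supI2)
  finally have "s \<le> sup e (sup k (\<Delta> w h))"
    using assms by simp
  moreover have "s \<le> e \<leadsto> k"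
    using es le_arrow_iff by blast
  ultimately have "s \<le> sup k (\<Delta> w h)"
    by (rule cut) simp
  then have "\<Delta> w s \<le> \<Delta> w (sup k (\<Delta> w h))"
    by (rule Delta_mono) (simp add: kw hw Delta_le)
  also have "\<dots> = sup (\<Delta> w k) h"
    by (simp add: Delta_join[OF kw Delta_le[OF hw]] Delta_invol[OF hw])
  also have "\<dots> \<le> sup h (\<Delta> top k)"
    using Delta_le_sup[OF ke ew] by (simp add: h_def)
  also have "\<dots> = e \<leadsto> h"
    by (simp add: arrow_eq[OF he[unfolded h_def]] h_def Delta_invol[OF ke] sup_commute)
  finally have ws: "\<Delta> w s \<le> e \<leadsto> h" .
  \<comment> \<open>Modus ponens at \<open>e\<close> yields \<open>g \<le> h\<close>. For the
    converse it is used at \<open>s\<close>, on the reflection of \<open>h\<close> in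
    \<open>w\<close>.\<close>
  have "g \<le> \<Delta> w s"
    unfolding g_def using js assms(2) by (rule Delta_mono)
  then have gh: "g \<le> h"
    using ws modus_ponens[of g e h] by (simp add: e_def)
  have "\<Delta> w h \<le> \<Delta> w e"
    using he ew by (rule Delta_mono)
  also have "\<dots> = sup (\<Delta> w k) j"
    by (simp add: e_def g_def Delta_join[OF kw Delta_le[OF jw]] Delta_invol[OF jw])
  also have "\<dots> \<le> sup j (\<Delta> top k)"
    using Delta_le_sup[OF assms] by (simp add: j_def)
  also have "\<dots> = s \<leadsto> j"
    by (simp add: arrow_eq[OF js[unfolded j_def]] j_def Delta_invol[OF assms(1)] sup_commute)
  finally have "\<Delta> w h \<le> j"
    using hs by (rule modus_ponens[rotated])
  then have "h \<le> g"
    unfolding g_def by (rule Delta_le_swap[OF hw jw])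
  with gh show ?thesis
    by (simp add: h_def e_def g_def j_def)
qed

section \<open>Similarity is an equivalence relation\<close>

lemma sim_iff: "a \<simeq> b \<longleftrightarrow> \<Delta> (sup a b) a = b"
  by (simp add: sim_rel_def)

lemma sim_Delta: "p \<le> x \<Longrightarrow> p \<simeq> \<Delta> x p"
  using Delta_sup[of p x] by (simp add: sim_iff sup_commute[of p])

lemma sim_refl: "a \<simeq> a"
  by (simp add: sim_iff)

lemma sim_sym: "a \<simeq> b \<Longrightarrow> b \<simeq> a"
  using Delta_invol[of a "sup a b"] by (simp add: sim_iff sup_commute[of b])

text \<open>Here \<open>e\<close> and \<open>f\<close> are the relative complements of \<open>x\<close> and \<open>y\<close> in the interval from \<open>p\<close> to \<open>w\<close>, and
  \<open>m\<close> is their symmetric difference, hence that of \<open>x\<close> and \<open>y\<close>.\<close>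

lemma Delta_sim_Delta:
  assumes "p \<le> x" "p \<le> y"
  shows "\<Delta> x p \<simeq> \<Delta> y p"
proof -
  define w where "w = sup x y"
  define e where "e = sup p (\<Delta> w (\<Delta> x p))"
  define f where "f = sup p (\<Delta> w (\<Delta> y p))"
  define m where "m = sup e f"
  have le: "p \<le> w" "x \<le> w" "y \<le> w" "p \<le> e" "p \<le> f" "e \<le> m" "f \<le> m" "\<Delta> x p \<le> w" "\<Delta> y p \<le> w"
    using assms by (simp_all add: w_def e_def f_def m_def le_supI1 le_supI2 Delta_le)
  have mw: "m \<le> w"
    using le by (simp add: m_def e_def f_def Delta_le)
  have e: "\<Delta> w (\<Delta> x p) = \<Delta> e p"
    using Delta_Delta_nested[OF assms(1) le(2)] by (simp add: e_def)
  have f: "\<Delta> w (\<Delta> y p) = \<Delta> f p"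
    using Delta_Delta_nested[OF assms(2) le(3)] by (simp add: f_def)
  define f1 where "f1 = sup p (\<Delta> m (\<Delta> e p))"
  have f1: "\<Delta> m (\<Delta> e p) = \<Delta> f1 p"
    unfolding f1_def by (rule Delta_Delta_nested[OF le(4,6)])
  \<comment> \<open>\<open>e\<close> and \<open>f\<close> are disjoint relative to \<open>p\<close>,
    because \<open>f\<close> lies below \<open>x\<close>. Hence \<open>f\<close> is the complement
    of \<open>e\<close> in the interval from \<open>p\<close> to \<open>m\<close>, as is
    \<open>f1\<close>.\<close>
  have ef: "e \<le> f \<leadsto> p"
  proof -
    have "e \<le> x \<leadsto> p"
      using Delta_Delta_le_arrow[OF assms(1) le(2)] by (simp add: e_def le_arrow)
    moreover have "f \<le> x"
      using Delta_Delta_le[OF assms(2,1)] assms(1) by (simp add: f_def w_def sup_commute)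
    ultimately show ?thesis
      using arrow_antimono order_trans by blast
  qed
  have "f1 = f"
  proof (rule order_antisym)
    show "f1 \<le> f"
      using Delta_Delta_le[OF le(4,5)] le(5) by (simp add: f1_def m_def)
    have "m = sup (\<Delta> m (\<Delta> e p)) (\<Delta> e p)"
      using le by (metis Delta_le Delta_sup order_trans)
    also have "\<dots> \<le> sup e f1"
      using Delta_le[OF le(4)] by (simp add: f1_def le_supI1 le_supI2)
    finally have "f \<le> sup e f1"
      using le by simp
    moreover have "f \<le> e \<leadsto> p"
      using ef le_arrow_iff by blast
    ultimately show "f \<le> f1"
      by (rule cut) (simp add: f1_def)
  qed
  then have "\<Delta> m (\<Delta> w (\<Delta> x p)) = \<Delta> w (\<Delta> y p)"
    using e f f1 by simp
  then have "\<Delta> y p = \<Delta> w (\<Delta> m (\<Delta> w (\<Delta> x p)))"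
    using le by (simp add: Delta_invol)
  \<comment> \<open>Conjugating the reflection in \<open>m\<close> by the one in \<open>w\<close>
    gives the reflection in \<open>\<Delta> w m\<close>, so a single reflection links the two
    elements.\<close>
  also have "\<dots> = \<Delta> (\<Delta> w m) (\<Delta> x p)"
    using Delta_Delta[of "\<Delta> w (\<Delta> x p)" m w] e le mw Delta_le[OF le(4)]
    by (metis Delta_invol order_trans)
  finally have eq: "\<Delta> y p = \<Delta> (\<Delta> w m) (\<Delta> x p)" .
  have "\<Delta> x p \<le> \<Delta> w m"
    using e le mw Delta_le[OF le(4)] by (metis Delta_le_swap order_trans)
  then show ?thesis
    unfolding eq by (rule sim_Delta)
qed

lemma sim_trans: "\<lbrakk>a \<simeq> b; b \<simeq> c\<rbrakk> \<Longrightarrow> a \<simeq> c"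
  using Delta_sim_Delta[of b "sup b a" "sup b c"] sim_sym[of a b] by (simp add: sim_iff[of b])

lemma equiv_sim: "equiv UNIV (sim_rel \<Delta>)"
proof (rule equivI)
  show "refl (sim_rel \<Delta>)"
    by (rule refl_onI) (simp_all add: sim_refl)
  show "sym (sim_rel \<Delta>)"
    by (rule symI) (rule sim_sym)
  show "trans (sim_rel \<Delta>)"
    by (rule transI) (rule sim_trans)
qed simp

section \<open>The preorder \<lesssim> and its invariance under similarity\<close>

lemma le_imp_subsim: "a \<le> b \<Longrightarrow> a \<lesssim> b"
  by (simp add: subsim_def sup_absorb2 Delta_le)

text \<open>The class of \<open>p\<close> has a member \<open>r\<close> below \<open>e\<close>.
  Reflecting \<open>r\<close> in \<open>sup r q\<close> gives \<open>q\<close>, and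
  \<open>Delta_Delta_le\<close> brings \<open>q\<close> back below \<open>e\<close>; as
  \<open>r \<le> e\<close>, the last reflection is the one in \<open>sup q e\<close>.\<close>

lemma sim_subsim_trans:
  assumes "q \<simeq> p" "p \<lesssim> e"
  shows "q \<lesssim> e"
proof -
  define r where "r = \<Delta> (sup p e) p"
  have re: "r \<le> e"
    using assms by (simp add: subsim_def r_def)
  have "r \<simeq> q"
    using assms sim_Delta[of p "sup p e"] sim_sym sim_trans unfolding r_def by (meson sup_ge1)
  then have "\<Delta> (sup (sup r q) e) q \<le> e"
    using Delta_Delta_le[of r "sup r q" e] re by (simp add: sim_iff)
  moreover have "sup (sup r q) e = sup q (sup r e)"
    by (simp add: ac_simps)
  ultimately show ?thesis
    by (simp add: subsim_def sup_absorb2[OF re])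
qed

text \<open>The reflection in \<open>sup c e\<close> is monotone and takes \<open>c\<close> to
  \<open>e\<close>, so it moves a representative below \<open>c\<close> to one below
  \<open>e\<close>.\<close>

lemma subsim_sim_trans:
  assumes "p \<lesssim> c" "c \<simeq> e"
  shows "p \<lesssim> e"
proof -
  define r where "r = \<Delta> (sup p c) p"
  have rc: "r \<le> c"
    using assms by (simp add: subsim_def r_def)
  have "p \<simeq> r"
    by (simp add: r_def sim_Delta)
  moreover have "r \<simeq> \<Delta> (sup c e) r"
    using rc by (simp add: sim_Delta le_supI1)
  moreover have "\<Delta> (sup c e) r \<lesssim> e"
    using Delta_mono[OF rc, of "sup c e"] assms(2) by (simp add: le_imp_subsim sim_iff)
  ultimately show ?thesis
    using sim_subsim_trans by blast
qed

lemma subsim_antisym: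
  assumes "a \<lesssim> b" "b \<lesssim> a"
  shows "a \<simeq> b"
proof -
  have "b \<le> \<Delta> (sup a b) a"
    using assms(2) by (intro Delta_le_swap) (simp_all add: subsim_def sup_commute[of b])
  then show ?thesis
    using assms(1) by (simp add: subsim_def sim_iff)
qed

section \<open>Order and meets in the quotient\<close>

lemma sim_class_iff: "b \<in> sim_class \<Delta> a \<longleftrightarrow> a \<simeq> b"
  by (simp add: sim_class_def)

lemma sim_class_eq_iff: "sim_class \<Delta> a = sim_class \<Delta> b \<longleftrightarrow> a \<simeq> b"
  unfolding sim_class_def using eq_equiv_class_iff[OF equiv_sim] by simp

lemma sim_class_top: "sim_class \<Delta> top = {top}"
  by (auto simp: sim_class_iff sim_iff sup_absorb1)

lemma Imp_eq_top_iff: "Imp \<Delta> a b = top \<longleftrightarrow> a \<lesssim> b"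
  by (simp add: Imp_def arrow_eq_top_iff subsim_def)

text \<open>The class of \<open>top\<close> is a singleton, so the union in \<open>class_imp\<close>
  equals it exactly when \<open>Imp\<close> is \<open>top\<close> on all representatives; invariance
  of \<lesssim> reduces this to one pair.\<close>

lemma le_quotient_iff:
  "le (sim_quotient \<Delta>) (sim_class \<Delta> a) (sim_class \<Delta> b) \<longleftrightarrow> a \<lesssim> b"
proof -
  have "a \<lesssim> b" if "class_imp \<Delta> (sim_class \<Delta> a) (sim_class \<Delta> b) = {top}"
  proof -
    have "Imp \<Delta> a b \<in> class_imp \<Delta> (sim_class \<Delta> a) (sim_class \<Delta> b)"
      unfolding class_imp_def by (intro UN_I[of a] UN_I[of b]) (simp_all add: sim_class_iff sim_refl)
    then show ?thesis
      using that Imp_eq_top_iff by simp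
  qed
  moreover have "class_imp \<Delta> (sim_class \<Delta> a) (sim_class \<Delta> b) = {top}" if "a \<lesssim> b"
  proof -
    have "Imp \<Delta> a' b' = top" if "a \<simeq> a'" "b \<simeq> b'" for a' b'
      using that \<open>a \<lesssim> b\<close> Imp_eq_top_iff sim_sym sim_subsim_trans subsim_sim_trans by meson
    moreover have "a \<in> sim_class \<Delta> a" "b \<in> sim_class \<Delta> b"
      by (simp_all add: sim_class_iff sim_refl)
    ultimately show ?thesis
      unfolding class_imp_def by (auto simp: sim_class_iff sim_class_top)
  qed
  ultimately show ?thesis
    by (auto simp: sim_quotient_def sim_class_top)
qed

lemma carrier_sim_quotient: "carrier (sim_quotient \<Delta>) = range (sim_class \<Delta>)"
  by (auto simp: sim_quotient_def quotient_def sim_class_def)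

lemma is_glb_sim_quotient_iff:
  "is_glb (sim_quotient \<Delta>) (sim_class \<Delta> m) {sim_class \<Delta> a, sim_class \<Delta> b} \<longleftrightarrow>
    m \<lesssim> a \<and> m \<lesssim> b \<and> (\<forall>d. d \<lesssim> a \<and> d \<lesssim> b \<longrightarrow> d \<lesssim> m)"
  by (simp add: is_glb_pair_iff carrier_sim_quotient le_quotient_iff)

text \<open>The meet is a Hilbert choice, so uniqueness must be supplied; it comes from
  \<open>subsim_antisym\<close>.\<close>

lemma sim_quotient_meet_eqI:
  assumes "is_glb (sim_quotient \<Delta>) (sim_class \<Delta> m) {sim_class \<Delta> a, sim_class \<Delta> b}"
  shows "sim_class \<Delta> a \<sqinter>\<^bsub>sim_quotient \<Delta>\<^esub> sim_class \<Delta> b = sim_class \<Delta> m"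
  unfolding meet_def inf_def
proof (rule some_equality)
  show "is_glb (sim_quotient \<Delta>) (sim_class \<Delta> m) {sim_class \<Delta> a, sim_class \<Delta> b}"
    by (rule assms)
next
  fix M
  assume M: "is_glb (sim_quotient \<Delta>) M {sim_class \<Delta> a, sim_class \<Delta> b}"
  then have "M \<in> carrier (sim_quotient \<Delta>)"
    by (auto simp: greatest_def Lower_def)
  then obtain n where n: "M = sim_class \<Delta> n"
    by (auto simp: carrier_sim_quotient)
  show "M = sim_class \<Delta> m"
    using M assms subsim_antisym unfolding n is_glb_sim_quotient_iff sim_class_eq_iff by blast
qed

end

section \<open>Meets obtained from the MR-axiom\<close>

context MR_algebra
begin

lemma has_meet_of_Delta_sup:
  assumes "p \<le> v" "c \<le> v" "sup (\<Delta> v p) c = v"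
  shows "has_meet p c"
proof (cases "p = v \<or> c = v")
  \<comment> \<open>The MR-axiom speaks only of elements strictly below \<open>v\<close>; if one of
    the two is \<open>v\<close>, the other is the meet.\<close>
  case True
  then show ?thesis
    using assms(1,2) unfolding has_meet_def is_glb_type_order_iff by auto
next
  case False
  then show ?thesis
    using assms MR_axiom[of p v c] by (simp add: order_less_le)
qed

text \<open>Reflecting \<open>\<Delta> (sup a b) b\<close> in \<open>sup a b\<close> returns
  \<open>b\<close>, whose join with \<open>a\<close> is \<open>sup a b\<close>; so the meet exists
  and the choice inside \<open>caret\<close> picks a genuine one.\<close>

lemma caret_glb: "is_glb type_order (caret \<Delta> a b) {a, \<Delta> (sup a b) b}"
proof -
  have "has_meet (\<Delta> (sup a b) b) a"
    by (rule has_meet_of_Delta_sup[of _ "sup a b"]) (simp_all add: Delta_le Delta_invol sup_commute)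
  then have "\<exists>m. is_glb type_order m {a, \<Delta> (sup a b) b}"
    by (simp add: has_meet_def insert_commute)
  then show ?thesis
    unfolding caret_def meet_def inf_def by (rule someI_ex)
qed

lemma subsim_imp_Delta_le:
  assumes "d \<lesssim> e" "c \<le> e"
  shows "\<Delta> (sup d c) d \<le> e"
proof -
  define r where "r = \<Delta> (sup d c) d"
  define t where "t = sup r e"
  have "has_meet r c"
    by (rule has_meet_of_Delta_sup[of _ "sup d c"]) (simp_all add: r_def Delta_le Delta_invol)
  then obtain n where n: "n \<le> r" "n \<le> c"
    by (auto simp: has_meet_def is_glb_type_order_iff)
  have "r \<lesssim> e"
    using assms(1) sim_subsim_trans sim_sym sim_Delta unfolding r_def by (meson sup_ge1)
  then have "\<Delta> t r \<le> e"
    by (simp add: subsim_def t_def)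
  then have "\<Delta> t n \<le> e"
    using n Delta_mono order_trans unfolding t_def by (meson sup_ge1)
  moreover have "n \<le> e"
    using n assms(2) by simp
  moreover have "sup (\<Delta> t n) n = t"
    using n by (simp add: Delta_sup t_def le_supI1)
  \<comment> \<open>\<open>n\<close> and its reflection in \<open>t\<close> both lie below
    \<open>e\<close>, and their join is \<open>t\<close>.\<close>
  ultimately have "t \<le> e"
    by (metis le_supI)
  then show ?thesis
    by (simp add: t_def r_def)
qed

lemma caret_glb_quotient:
  "is_glb (sim_quotient \<Delta>) (sim_class \<Delta> (caret \<Delta> a b)) {sim_class \<Delta> a, sim_class \<Delta> b}"
  unfolding is_glb_sim_quotient_iff
proof (intro conjI allI impI)
  define b1 where "b1 = \<Delta> (sup a b) b"
  define c where "c = caret \<Delta> a b"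
  have c: "c \<le> a" "c \<le> b1" "\<And>z. \<lbrakk>z \<le> a; z \<le> b1\<rbrakk> \<Longrightarrow> z \<le> c"
    using caret_glb[of a b] by (auto simp: is_glb_type_order_iff c_def b1_def)
  have b: "b \<simeq> b1"
    by (simp add: b1_def sim_Delta)
  show "caret \<Delta> a b \<lesssim> a"
    using c by (simp add: le_imp_subsim c_def)
  show "caret \<Delta> a b \<lesssim> b"
    using c b le_imp_subsim subsim_sim_trans sim_sym unfolding c_def by blast
  fix d
  assume d: "d \<lesssim> a \<and> d \<lesssim> b"
  then have "d \<lesssim> b1"
    using b subsim_sim_trans by blast
  then have "\<Delta> (sup d c) d \<le> c"
    using c d by (simp add: subsim_imp_Delta_le)
  then show "d \<lesssim> caret \<Delta> a b"
    by (simp add: subsim_def c_def)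
qed

end

theorem theorem4p19:
  fixes \<Delta> :: "'a \<Rightarrow> 'a \<Rightarrow> 'a::{semilattice_sup,order_top}"
    and a b :: 'a
  assumes "MR_algebra \<Delta>"
  shows "(\<exists>M. is_glb (sim_quotient \<Delta>) M {sim_class \<Delta> a, sim_class \<Delta> b}) \<and>
         sim_class \<Delta> a \<sqinter>\<^bsub>sim_quotient \<Delta>\<^esub> sim_class \<Delta> b = sim_class \<Delta> (caret \<Delta> a b)"
proof -
  interpret MR_algebra \<Delta>
    by (rule assms)
  show ?thesis
    using caret_glb_quotient sim_quotient_meet_eqI by blast
qed

end
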